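(* For all integers $n\ge 1$ and $0\le\underline{k}\le\overline{k}$, the total number $\rho_{\underline{k}\le\overline{k}}(n)$ of runs of ones with length in $[\underline{k},\overline{k}]$ over all binary strings of length $n$ is $$\rho_{\underline{k}\le\overline{k}}(n)=(n-\underline{k}+2)\,2^{n-(\underline{k}+1)}\,[\![\underline{k}\le n]\!]-(n-\overline{k}+1)\,2^{n-(\overline{k}+2)}\,[\![\overline{k}<n]\!].$$
   Context: $[\![P]\!]$ is the Iverson bracket ($1$ if $P$ is true, $0$ otherwise). A run of ones is a maximal block of consecutive ones, flanked on each side by a zero or by the start/end of the string. Null runs (length $0$) of ones also count (when $\underline{k}=0$): there is one between every two consecutive zeros, one before an initial zero and one after a final zero; thus a string with $z$ zeros has exactly $z+1$ runs of ones (including null ones). *)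

theory Defs
  imports Complex_Main
begin

text \<open>
  Binary strings are Boolean lists, \<^term>\<open>True\<close> being the digit one. The pair \<open>(i, l)\<close> is the run
  of ones that starts at (0-based) position \<open>i\<close> and has length \<open>l\<close>. For \<open>l = 0\<close> the two flanking
  conditions describe exactly the null runs of a nonempty string: \<open>i = 0\<close> before an initial zero,
  \<open>i = length xs\<close> after a final zero, and otherwise the gap between two consecutive zeros.
\<close>

definition is_run_of_ones :: "bool list \<Rightarrow> nat \<Rightarrow> nat \<Rightarrow> bool" where
  "is_run_of_ones xs i l \<longleftrightarrow>
     i + l \<le> length xs \<and>
     (\<forall>j. i \<le> j \<and> j < i + l \<longrightarrow> xs ! j) \<and>
     (i = 0 \<or> \<not> xs ! (i - 1)) \<and>
     (i + l = length xs \<or> \<not> xs ! (i + l))"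

definition runs_of_ones :: "bool list \<Rightarrow> (nat \<times> nat) set" where
  "runs_of_ones xs = {(i, l). is_run_of_ones xs i l}"

definition rho :: "nat \<Rightarrow> nat \<Rightarrow> nat \<Rightarrow> nat" where
  "rho k_lo k_hi n =
     (\<Sum>xs | length xs = n. card {(i, l) \<in> runs_of_ones xs. k_lo \<le> l \<and> l \<le> k_hi})"

end

theory Submission
  imports Defs
begin

text \<open>
  The counts for the lengths in an interval are differences of the counts for the lengths
  \<open>\<ge> m\<close>, taken at \<open>m = k_lo\<close> and at \<open>m = k_hi + 1\<close>; these are the two terms of the formula.
  Counting runs of length \<open>\<ge> m\<close> is easy because such a run is determined by its starting position,
  and whether one starts at position \<open>i\<close> depends on a fixed window of the string only: \<open>m\<close> ones
  from \<open>i\<close> on, preceded by a zero unless \<open>i = 0\<close> (lemma \<open>card_long_runs\<close>).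

  Double counting finishes the proof. The window at \<open>i = 0\<close> fixes \<open>m\<close> digits and leaves
  \<open>2 ^ (n - m)\<close> strings; each of the \<open>n - m\<close> other positions fixes \<open>m + 1\<close> digits and
  leaves \<open>2 ^ (n - m - 1)\<close> strings (lemma \<open>card_strings_with_factor\<close>). The total is
  \<open>2 ^ (n - m) + (n - m) * 2 ^ (n - m - 1) = (n - m + 2) * 2 ^ (n - m - 1)\<close>, and it is \<open>0\<close> for
  \<open>m > n\<close> (lemma \<open>sum_card_long_runs\<close>).
\<close>

definition starts_long_run :: "nat \<Rightarrow> bool list \<Rightarrow> nat \<Rightarrow> bool" where
  "starts_long_run m xs i \<longleftrightarrow>
     i + m \<le> length xs \<and> (\<forall>j. i \<le> j \<and> j < i + m \<longrightarrow> xs ! j) \<and> (i = 0 \<or> \<not> xs ! (i - 1))"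

lemma run_length_le:
  assumes "is_run_of_ones xs i l" "is_run_of_ones xs i l'"
  shows "l \<le> l'"
proof (rule ccontr)
  assume "\<not> l \<le> l'"
  then have "xs ! (i + l')" "i + l' \<noteq> length xs"
    using assms(1) by (auto simp: is_run_of_ones_def)
  then show False
    using assms(2) by (auto simp: is_run_of_ones_def)
qed

lemma run_length_unique:
  "is_run_of_ones xs i l \<Longrightarrow> is_run_of_ones xs i l' \<Longrightarrow> l = l'"
  by (blast intro: order_antisym run_length_le)

text \<open>A block of ones that cannot be extended to the left becomes a run when it is extended as far
  as possible to the right.\<close>

lemma starts_long_run_iff:
  "starts_long_run m xs i \<longleftrightarrow> (\<exists>l\<ge>m. is_run_of_ones xs i l)"
proof
  assume start: "starts_long_run m xs i"
  define L where "L = (GREATEST l. starts_long_run l xs i)"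
  have bound: "l \<le> length xs" if "starts_long_run l xs i" for l
    using that by (auto simp: starts_long_run_def)
  have L: "starts_long_run L xs i"
    unfolding L_def by (rule GreatestI_nat[where k = m and b = "length xs"]) (use start bound in auto)
  have le_L: "l \<le> L" if "starts_long_run l xs i" for l
    unfolding L_def by (rule Greatest_le_nat[where b = "length xs"]) (use that bound in auto)
  have "i + L = length xs \<or> \<not> xs ! (i + L)"
  proof (rule ccontr)
    assume "\<not> ?thesis"
    with L have "starts_long_run (Suc L) xs i"
      by (auto simp: starts_long_run_def less_Suc_eq)
    from le_L[OF this] show False by simp
  qed
  with L have "is_run_of_ones xs i L"
    by (simp add: starts_long_run_def is_run_of_ones_def)
  with le_L[OF start] show "\<exists>l\<ge>m. is_run_of_ones xs i l" by blast
qed (auto simp: starts_long_run_def is_run_of_ones_def)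

lemma finite_runs_of_ones: "finite (runs_of_ones xs)"
  by (rule finite_subset[of _ "{..length xs} \<times> {..length xs}"])
    (auto simp: runs_of_ones_def is_run_of_ones_def)

lemma card_long_runs:
  "card {(i, l) \<in> runs_of_ones xs. m \<le> l} = card {i. starts_long_run m xs i}"
proof -
  let ?R = "{(i, l) \<in> runs_of_ones xs. m \<le> l}"
  have "inj_on fst ?R"
  proof (rule inj_onI)
    fix p q assume "p \<in> ?R" "q \<in> ?R" and eq: "fst p = fst q"
    then have "is_run_of_ones xs (fst p) (snd p)" "is_run_of_ones xs (fst p) (snd q)"
      by (auto simp: runs_of_ones_def)
    then have "snd p = snd q" by (rule run_length_unique)
    with eq show "p = q" by (rule prod_eqI)
  qed
  moreover have "fst ` ?R = {i. starts_long_run m xs i}"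
    by (auto simp: starts_long_run_iff runs_of_ones_def image_iff Bex_def)
  ultimately show ?thesis using card_image[of fst ?R] by simp
qed

lemma card_runs_between:
  assumes "k_lo \<le> k_hi"
  shows "card {(i, l) \<in> runs_of_ones xs. k_lo \<le> l \<and> l \<le> k_hi} + card {i. starts_long_run (Suc k_hi) xs i}
       = card {i. starts_long_run k_lo xs i}"
proof -
  have "{(i, l) \<in> runs_of_ones xs. k_lo \<le> l} =
      {(i, l) \<in> runs_of_ones xs. k_lo \<le> l \<and> l \<le> k_hi} \<union> {(i, l) \<in> runs_of_ones xs. Suc k_hi \<le> l}"
    using assms by auto
  moreover have "finite {(i, l) \<in> runs_of_ones xs. P l}" for P
    by (rule finite_subset[OF _ finite_runs_of_ones[of xs]]) auto
  ultimately show ?thesis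
    unfolding card_long_runs[symmetric] by (subst card_Un_disjoint[symmetric]) auto
qed

text \<open>Prescribing a word \<open>w\<close> at position \<open>p\<close> leaves the prefix and the suffix free.\<close>

lemma card_strings_with_factor:
  fixes w :: "bool list"
  assumes "p + length w \<le> n"
  shows "card {xs. length xs = n \<and> (\<forall>j<length w. xs ! (p + j) = w ! j)} = 2 ^ (n - length w)"
proof -
  define q where "q = n - p - length w"
  let ?S = "\<lambda>k. {xs :: bool list. length xs = k}"
  let ?f = "\<lambda>(ys, zs). ys @ w @ zs"
  have n: "n = p + length w + q" using assms by (simp add: q_def)
  have card_S: "card (?S k) = 2 ^ k" for k
    using card_lists_length_eq[of "UNIV :: bool set" k] by simp
  have "{xs. length xs = n \<and> (\<forall>j<length w. xs ! (p + j) = w ! j)} = ?f ` (?S p \<times> ?S q)"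
  proof (intro equalityI subsetI)
    fix xs assume "xs \<in> {xs. length xs = n \<and> (\<forall>j<length w. xs ! (p + j) = w ! j)}"
    then have len: "length xs = n" and w: "\<And>j. j < length w \<Longrightarrow> xs ! (p + j) = w ! j" by auto
    have "take (length w) (drop p xs) = w"
      using len n w by (intro nth_equalityI) auto
    then have "xs = ?f (take p xs, drop (length w) (drop p xs))"
      by (metis append_take_drop_id case_prod_conv)
    moreover have "(take p xs, drop (length w) (drop p xs)) \<in> ?S p \<times> ?S q"
      using len n by auto
    ultimately show "xs \<in> ?f ` (?S p \<times> ?S q)" by (rule image_eqI)
  qed (auto simp: n nth_append)
  moreover have "inj_on ?f (?S p \<times> ?S q)" by (auto simp: inj_on_def)
  ultimately have "card {xs. length xs = n \<and> (\<forall>j<length w. xs ! (p + j) = w ! j)} = card (?S p \<times> ?S q)"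
    by (simp add: card_image)
  also have "\<dots> = 2 ^ (n - length w)"
    by (simp add: card_cartesian_product card_S n power_add)
  finally show ?thesis .
qed

lemma card_starts_long_run_0:
  assumes "m \<le> n"
  shows "card {xs. length xs = n \<and> starts_long_run m xs 0} = 2 ^ (n - m)"
proof -
  have "{xs. length xs = n \<and> starts_long_run m xs 0} =
      {xs. length xs = n \<and> (\<forall>j<length (replicate m True). xs ! (0 + j) = replicate m True ! j)}"
    using assms by (auto simp: starts_long_run_def)
  then show ?thesis
    using card_strings_with_factor[of 0 "replicate m True" n] assms by simp
qed

lemma card_starts_long_run_Suc:
  assumes "Suc i + m \<le> n"
  shows "card {xs. length xs = n \<and> starts_long_run m xs (Suc i)} = 2 ^ (n - m - 1)"
proof -
  let ?w = "False # replicate m True"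
  have "starts_long_run m xs (Suc i) \<longleftrightarrow> (\<forall>j<length ?w. xs ! (i + j) = ?w ! j)"
    if "length xs = n" for xs
  proof -
    have "(\<forall>j. Suc i \<le> j \<and> j < Suc i + m \<longrightarrow> xs ! j) \<longleftrightarrow> (\<forall>j<m. xs ! (Suc i + j))"
    proof (intro iffI allI impI)
      fix j assume ones: "\<forall>j<m. xs ! (Suc i + j)" and j: "Suc i \<le> j \<and> j < Suc i + m"
      then have "j - Suc i < m" by linarith
      with ones have "xs ! (Suc i + (j - Suc i))" by blast
      with j show "xs ! j" by simp
    qed simp
    then show ?thesis
      using that assms by (auto simp: starts_long_run_def All_less_Suc2)
  qed
  then have "{xs. length xs = n \<and> starts_long_run m xs (Suc i)} =
      {xs. length xs = n \<and> (\<forall>j<length ?w. xs ! (i + j) = ?w ! j)}"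
    by blast
  then show ?thesis
    using card_strings_with_factor[of i ?w n] assms by simp
qed

lemma sum_card_starts:
  "(\<Sum>xs | length xs = n. card {i. starts_long_run m xs i}) =
   (\<Sum>i | i + m \<le> n. card {xs. length xs = n \<and> starts_long_run m xs i})"
proof -
  let ?S = "{xs :: bool list. length xs = n}"
  let ?I = "{i. i + m \<le> n}"
  have fin: "finite ?S" "finite ?I"
    using finite_lists_length_eq[of "UNIV :: bool set" n]
    by (auto intro: finite_subset[of _ "{..n}"])
  have "(\<Sum>xs\<in>?S. card {i. starts_long_run m xs i}) = (\<Sum>xs\<in>?S. \<Sum>i | i \<in> ?I \<and> starts_long_run m xs i. 1)"
    by (intro sum.cong refl) (auto simp: starts_long_run_def intro!: arg_cong[of _ _ card])
  also have "\<dots> = (\<Sum>i\<in>?I. \<Sum>xs | xs \<in> ?S \<and> starts_long_run m xs i. 1)"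
    by (rule sum.swap_restrict[OF fin])
  finally show ?thesis by simp
qed

lemma sum_card_long_runs:
  "real (\<Sum>xs | length xs = n. card {i. starts_long_run m xs i}) =
   (real n - real m + 2) * 2 powi (int n - (int m + 1)) * of_bool (m \<le> n)"
proof (cases "m \<le> n")
  case True
  define d where "d = n - m"
  have n: "n = m + d" using True by (simp add: d_def)
  have "{i. i + m \<le> n} = {..<Suc d}" by (auto simp: n)
  then have "(\<Sum>xs | length xs = n. card {i. starts_long_run m xs i}) =
      (\<Sum>i<Suc d. card {xs. length xs = n \<and> starts_long_run m xs i})"
    by (simp only: sum_card_starts)
  also have "\<dots> = 2 ^ d + (\<Sum>i<d. 2 ^ (d - 1))"
    unfolding sum.lessThan_Suc_shift
    using card_starts_long_run_0[of m n] card_starts_long_run_Suc[of _ m n]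
    by (intro arg_cong2[of _ _ _ _ "(+)"] sum.cong) (auto simp: n)
  finally have eq: "(\<Sum>xs | length xs = n. card {i. starts_long_run m xs i}) = 2 ^ d + d * 2 ^ (d - 1)"
    by simp
  show ?thesis
  \<comment> \<open>For \<open>d = 0\<close> the truncated exponent \<open>d - 1\<close> differs from the integer exponent \<open>-1\<close> of the
    claim, which is then \<open>2 * 2 powi -1 = 1\<close>.\<close>
  proof (cases d)
    case 0
    then show ?thesis unfolding eq by (simp add: n power_int_minus)
  next
    case (Suc e)
    then have "int n - (int m + 1) = int e" by (simp add: n)
    then show ?thesis unfolding eq using Suc by (simp add: n algebra_simps)
  qed
next
  case False
  then have "{i. starts_long_run m xs i} = {}" if "length xs = n" for xs
    using that by (auto simp: starts_long_run_def)
  then show ?thesis using False by simp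
qed

theorem mainTheorem18:
  fixes n k_lo k_hi :: nat
  assumes "n \<ge> 1" and "k_lo \<le> k_hi"
  shows "real (rho k_lo k_hi n) =
      (real n - real k_lo + 2) * 2 powi (int n - (int k_lo + 1)) * of_bool (k_lo \<le> n)
    - (real n - real k_hi + 1) * 2 powi (int n - (int k_hi + 2)) * of_bool (k_hi < n)"
proof -
  have "rho k_lo k_hi n + (\<Sum>xs | length xs = n. card {i. starts_long_run (Suc k_hi) xs i})
      = (\<Sum>xs | length xs = n. card {i. starts_long_run k_lo xs i})"
    unfolding rho_def sum.distrib[symmetric] card_runs_between[OF assms(2)] ..
  then have "real (rho k_lo k_hi n) =
      real (\<Sum>xs | length xs = n. card {i. starts_long_run k_lo xs i}) -
      real (\<Sum>xs | length xs = n. card {i. starts_long_run (Suc k_hi) xs i})"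
    by linarith
  moreover have "real n - real (Suc k_hi) + 2 = real n - real k_hi + 1"
    "int n - (int (Suc k_hi) + 1) = int n - (int k_hi + 2)" by simp_all
  ultimately show ?thesis
    by (simp only: sum_card_long_runs Suc_le_eq)
qed

end
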